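(* Let $p$ be a prime and let $k$, $c$, $d$ be integers with $1 \leq k \leq c \leq d < c+d \leq p$. For every integer $\ell \in [1, c+d+1-k]$ define \[C(\ell)=\sum_{j=1}^{c+1-k} \binom{k+j-2}{k-1}\binom{c+d-k}{d+j-1}\binom{p-c-d+2k-2}{k+j-1-\ell}\] and \[D(\ell)=\sum_{j=1}^{d+1-k}\binom{d-j}{k-1}\binom{c+d-k}{j-1}\binom{p-c-d+2k-2}{p+k+j-d-1-\ell},\] and let $f(\ell)=C(\ell)+(-1)^k D(\ell)$. Then $f(1)\not\equiv 0 \pmod p$, and $f(\ell)\equiv (-1)^{\ell-1} f(1) \pmod p$ for every integer $\ell\in[1,c+d+1-k]$.
   Context: Binomial coefficients follow the convention: for an integer $n$ and an integer $m\ge 0$, $\binom{n}{m}=n(n-1)\cdots(n-m+1)/m!$, and $\binom{n}{m}=0$ for integers $m<0$. *)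

theory Defs
  imports "HOL-Number_Theory.Number_Theory"
begin

(* The division is exact (see ibinom_mult_fact). The product is gbinomial at type int,
   written out because the type constraint on gbinomial does not admit int here. *)
definition ibinom :: "int \<Rightarrow> int \<Rightarrow> int" where
  "ibinom n m = (if m < 0 then 0 else (\<Prod>i = 0..<nat m. n - int i) div fact (nat m))"

lemma ibinom_mult_fact: "ibinom n (int m) * fact m = (\<Prod>i = 0..<m. n - int i)"
proof -
  have "fact m dvd (\<Prod>i = 0..<m. n - int i)"
    by (simp only: falling_fact_pochhammer' fact_dvd_pochhammer)
  then show ?thesis
    by (simp add: ibinom_def)
qed

lemma ibinom_of_nat: "ibinom (int n) (int m) = int (n choose m)"
  by (simp add: ibinom_def flip: int_binomial[unfolded gbinomial_prod_rev])

definition C_sum :: "int \<Rightarrow> int \<Rightarrow> int \<Rightarrow> int \<Rightarrow> int \<Rightarrow> int" where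
  "C_sum p k c d l =
     (\<Sum>j\<in>{1..c + 1 - k}. ibinom (k + j - 2) (k - 1) * ibinom (c + d - k) (d + j - 1)
        * ibinom (p - c - d + 2 * k - 2) (k + j - 1 - l))"

definition D_sum :: "int \<Rightarrow> int \<Rightarrow> int \<Rightarrow> int \<Rightarrow> int \<Rightarrow> int" where
  "D_sum p k c d l =
     (\<Sum>j\<in>{1..d + 1 - k}. ibinom (d - j) (k - 1) * ibinom (c + d - k) (j - 1)
        * ibinom (p - c - d + 2 * k - 2) (p + k + j - d - 1 - l))"

definition f_sum :: "int \<Rightarrow> int \<Rightarrow> int \<Rightarrow> int \<Rightarrow> int \<Rightarrow> int" where
  "f_sum p k c d l = C_sum p k c d l + (-1) ^ nat k * D_sum p k c d l"

end

theory Submission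
  imports Defs "HOL-Computational_Algebra.Formal_Power_Series"
begin

text \<open>
  Write \<open>K = k - 1\<close>, \<open>a = d - K\<close>, \<open>M = c + d - k\<close> and \<open>N = p - c - d + 2 k - 2\<close>, so that \<open>M + N = p - 1 + K\<close>.
  By upper negation the coefficients of \<open>D\<close> continue those of \<open>C\<close>, and all terms missing from
  either sum vanish, so \<open>f(l)\<close> is one sum over \<open>0 \<le> i \<le> M\<close> with weights \<open>binom(i - a, K) binom(M, i)\<close>
  applied to \<open>binom(N, i - m) - binom(N, i - m + p)\<close>, where \<open>m = a - 1 + l\<close>. Expanding \<open>binom(i - a, K)\<close> by
  Vandermonde and summing over \<open>i\<close> by Vandermonde again turns this into
  \<open>\<Sum>s\<le>K. binom(-a, K - s) binom(M, s) h(K - s, N + m - s)\<close> with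
  \<open>h(t, n) = binom(p - 1 + t, n) - binom(p - 1 + t, n - p)\<close>. For \<open>t \<le> n < 2 p\<close>, modulo \<open>p\<close>, \<open>h(0, n)\<close> is
  \<open>(-1)^n\<close> and \<open>h(t, n)\<close> vanishes if \<open>t > 0\<close>. Only \<open>s = K\<close> survives and \<open>f(l)\<close> is congruent to
  \<open>(-1)^(N + m - K) binom(M, K)\<close>, which is nonzero because \<open>M < p\<close>.
\<close>

section \<open>Binomial coefficients with integer arguments\<close>

lemma ibinom_neg: "m < 0 \<Longrightarrow> ibinom n m = 0"
  by (simp add: ibinom_def)

lemma ibinom_eq_0: "0 \<le> n \<Longrightarrow> n < m \<Longrightarrow> ibinom n m = 0"
  using ibinom_of_nat[of "nat n" "nat m"] by simp

lemma ibinom_Pascal: "ibinom (1 + int n) m = ibinom (int n) m + ibinom (int n) (m - 1)"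
proof (cases "m \<le> 0")
  case True
  then show ?thesis
    by (cases "m = 0") (simp_all add: ibinom_def)
next
  case False
  then obtain r where m: "m = int (Suc r)"
    using zero_less_imp_eq_int[of m] by (auto simp: gr0_conv_Suc)
  have eqs: "int (Suc r) - 1 = int r" "1 + int n = int (Suc n)"
    by simp_all
  show ?thesis
    unfolding m eqs ibinom_of_nat by simp
qed

lemma ibinom_symmetric: "ibinom (int n) m = ibinom (int n) (int n - m)"
proof (cases "0 \<le> m \<and> m \<le> int n")
  case True
  then obtain r where r: "m = int r" "r \<le> n"
    using zero_le_imp_eq_int[of m] by auto
  then have "int n - m = int (n - r)"
    by simp
  then show ?thesis
    using r binomial_symmetric[OF r(2)] by (simp only: ibinom_of_nat)
next
  case False
  then show ?thesis
    by (cases "m < 0") (simp_all add: ibinom_neg ibinom_eq_0)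
qed

text \<open>Identities for \<open>gchoose\<close> over the rationals pull back to
  \<open>ibinom\<close> because \<open>of_int\<close> is injective.\<close>

lemma of_int_ibinom: "(of_int (ibinom n (int m)) :: rat) = of_int n gchoose m"
proof -
  have "(of_int (ibinom n (int m) * fact m) :: rat) = (\<Prod>i = 0..<m. of_int n - of_nat i)"
    unfolding ibinom_mult_fact by simp
  then show ?thesis
    by (simp add: gbinomial_prod_rev divide_simps)
qed

lemma ibinom_negated_upper: "ibinom n (int m) = (- 1) ^ m * ibinom (int m - n - 1) (int m)"
proof -
  have "(of_int (ibinom n (int m)) :: rat) = of_int ((- 1) ^ m * ibinom (int m - n - 1) (int m))"
    using gbinomial_negated_upper[of "of_int n :: rat" m] by (simp add: of_int_ibinom)
  then show ?thesis
    by (simp only: of_int_eq_iff)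
qed

section \<open>Vandermonde convolutions\<close>

lemma ibinom_Vandermonde_upper:
  "ibinom (int i + x) (int m) = (\<Sum>s\<le>m. int (i choose s) * ibinom x (int (m - s)))"
proof -
  have "(of_int (ibinom (int i + x) (int m)) :: rat) =
    of_int (\<Sum>s\<le>m. int (i choose s) * ibinom x (int (m - s)))"
    using gbinomial_Vandermonde[of "of_nat i :: rat" "of_int x" m]
    by (simp add: of_int_ibinom binomial_gbinomial atLeast0AtMost del: of_nat_diff)
  then show ?thesis
    by (simp only: of_int_eq_iff)
qed

lemma ibinom_Vandermonde_lower:
  "(\<Sum>i\<le>A. int (A choose i) * ibinom (int n) (r - int i)) = ibinom (int (A + n)) r"
proof (induction A arbitrary: r)
  case 0
  then show ?case by simp
next
  case (Suc A)
  have "(\<Sum>i\<le>Suc A. int (Suc A choose i) * ibinom (int n) (r - int i)) =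
      (\<Sum>i\<le>Suc A. int (A choose i) * ibinom (int n) (r - int i)) +
      (\<Sum>i\<le>A. int (A choose i) * ibinom (int n) (r - 1 - int i))"
    unfolding sum.atMost_Suc_shift
    by (simp add: sum.distrib algebra_simps)
  also have "\<dots> = ibinom (int (A + n)) r + ibinom (int (A + n)) (r - 1)"
    by (simp add: Suc.IH)
  also have "\<dots> = ibinom (int (Suc A + n)) r"
    using ibinom_Pascal[of "A + n" r] by (simp add: algebra_simps)
  finally show ?case .
qed

text \<open>Trinomial revision moves \<open>s\<close> out of the sum, and symmetry turns the last
  lower index into \<open>N + m - i\<close>; what remains is a Vandermonde sum.\<close>

lemma sum_binomial_product:
  assumes "s \<le> M"
  shows "(\<Sum>i\<le>M. int (i choose s) * int (M choose i) * ibinom (int N) (int i - m)) =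
    int (M choose s) * ibinom (int (M - s + N)) (int N + m - int s)"
proof -
  have "(\<Sum>i\<le>M. int (i choose s) * int (M choose i) * ibinom (int N) (int i - m)) =
      (\<Sum>i\<in>{s..M}. int (i choose s) * int (M choose i) * ibinom (int N) (int i - m))"
    by (rule sum.mono_neutral_right) auto
  also have "\<dots> = (\<Sum>i\<in>{s..M}. int (M choose s) *
      (int (M - s choose (i - s)) * ibinom (int N) (int N + m - int s - int (i - s))))"
  proof (rule sum.cong)
    fix i assume i: "i \<in> {s..M}"
    then have *: "int (i choose s) * int (M choose i) = int (M choose s) * int (M - s choose (i - s))"
      using choose_mult[of s i M] by (simp add: mult.commute flip: of_nat_mult)
    have "ibinom (int N) (int i - m) = ibinom (int N) (int N + m - int s - int (i - s))"
      using i by (subst ibinom_symmetric) (simp add: of_nat_diff algebra_simps)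
    then show "int (i choose s) * int (M choose i) * ibinom (int N) (int i - m) =
      int (M choose s) *
        (int (M - s choose (i - s)) * ibinom (int N) (int N + m - int s - int (i - s)))"
      using * by simp
  qed simp
  also have "\<dots> = (\<Sum>i\<le>M - s. int (M choose s) *
      (int (M - s choose i) * ibinom (int N) (int N + m - int s - int i)))"
    by (rule sum.reindex_bij_witness[of _ "\<lambda>i. i + s" "\<lambda>i. i - s"]) (use assms in auto)
  also have "\<dots> = int (M choose s) * ibinom (int (M - s + N)) (int N + m - int s)"
    by (simp only: ibinom_Vandermonde_lower flip: sum_distrib_left)
  finally show ?thesis .
qed

lemma sum_shifted_binomial_product:
  assumes "K \<le> M"
  shows "(\<Sum>i\<le>M. ibinom (int i - a) (int K) * int (M choose i) * ibinom (int N) (int i - m)) =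
    (\<Sum>s\<le>K. ibinom (- a) (int (K - s)) * int (M choose s) *
      ibinom (int (M - s + N)) (int N + m - int s))"
proof -
  have "(\<Sum>i\<le>M. ibinom (int i - a) (int K) * int (M choose i) * ibinom (int N) (int i - m)) =
    (\<Sum>i\<le>M. \<Sum>s\<le>K. ibinom (- a) (int (K - s)) *
      (int (i choose s) * int (M choose i) * ibinom (int N) (int i - m)))"
    using ibinom_Vandermonde_upper[of _ "- a" K]
    by (simp add: sum_distrib_right sum_distrib_left algebra_simps)
  also have "\<dots> = (\<Sum>s\<le>K. ibinom (- a) (int (K - s)) *
      (\<Sum>i\<le>M. int (i choose s) * int (M choose i) * ibinom (int N) (int i - m)))"
    by (subst sum.swap) (simp add: sum_distrib_left)
  also have "\<dots> = (\<Sum>s\<le>K. ibinom (- a) (int (K - s)) * int (M choose s) *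
      ibinom (int (M - s + N)) (int N + m - int s))"
    using assms by (intro sum.cong refl) (subst sum_binomial_product, auto)
  finally show ?thesis .
qed

section \<open>Differences of binomial coefficients modulo \<open>p\<close>\<close>

context
  fixes p :: nat
  assumes prime_p: "prime p"
begin

text \<open>The function \<open>h\<close> of the overview: the coefficient of x^n in (1 - x^p) (1 +
  x)^(p-1+t). Modulo \<open>p\<close> this polynomial is (1 - x^(2p)) (1 + x)^(t-1), which explains
  the congruences below.\<close>

definition cyc_diff :: "nat \<Rightarrow> int \<Rightarrow> int" where
  "cyc_diff t n = ibinom (int (p - 1 + t)) n - ibinom (int (p - 1 + t)) (n - int p)"

lemma cyc_diff_Suc: "cyc_diff (Suc t) n = cyc_diff t n + cyc_diff t (n - 1)"
  using ibinom_Pascal[of "p - 1 + t" n] ibinom_Pascal[of "p - 1 + t" "n - int p"]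
  by (simp add: cyc_diff_def algebra_simps)

lemma cyc_diff_1:
  assumes "0 < n" "n < 2 * int p"
  shows "int p dvd cyc_diff 1 n"
proof -
  have dvd: "int p dvd ibinom (int p) r" if r: "0 < r" "r < int p" for r
  proof -
    obtain q where q: "r = int q"
      using r zero_le_imp_eq_int[of r] by auto
    then show ?thesis
      using r dvd_choose_prime[of q p] prime_p prime_gt_0_nat[OF prime_p] by (simp add: ibinom_of_nat)
  qed
  have p: "p - 1 + 1 = p"
    using prime_gt_0_nat[OF prime_p] by simp
  consider "n < int p" | "n = int p" | "int p < n" by linarith
  then show ?thesis
  proof cases
    case 1
    then show ?thesis
      using assms dvd by (simp add: cyc_diff_def p ibinom_neg del: One_nat_def)
  next
    \<comment> \<open>Here the two terms are binom(p, p) and binom(p, 0), which cancel; in the other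
      cases one term vanishes and the other is divisible by \<open>p\<close>.\<close>
    case 2
    then show ?thesis
      using ibinom_of_nat[of p p] ibinom_of_nat[of p 0]
      by (simp add: cyc_diff_def p del: One_nat_def)
  next
    case 3
    then show ?thesis
      using assms dvd by (simp add: cyc_diff_def p ibinom_eq_0 del: One_nat_def)
  qed
qed

text \<open>A Pascal step needs both \<open>n\<close> and \<open>n - 1\<close> in range, so the
  lower bound rises by one with each \<open>t\<close>.\<close>

lemma cyc_diff_Suc_dvd:
  assumes "int t < n" "n < 2 * int p"
  shows "int p dvd cyc_diff (Suc t) n"
  using assms
proof (induction t arbitrary: n)
  case 0
  then show ?case
    using cyc_diff_1 by simp
next
  case (Suc t)
  then show ?case
    unfolding cyc_diff_Suc[of "Suc t"] by (intro dvd_add Suc.IH) auto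
qed

text \<open>Neighbouring values add up to a value of \<open>cyc_diff 1\<close>, divisible by
  \<open>p\<close>, so the sign alternates from 1 at \<open>n = 0\<close>.\<close>

lemma cyc_diff_0:
  assumes "n < 2 * p"
  shows "[cyc_diff 0 (int n) = (- 1) ^ n] (mod int p)"
  using assms
proof (induction n)
  case 0
  then show ?case
    using ibinom_of_nat[of "p - 1" 0] prime_gt_0_nat[OF prime_p]
    by (simp add: cyc_diff_def ibinom_neg)
next
  case (Suc n)
  have "int p dvd cyc_diff 0 (int (Suc n)) + cyc_diff 0 (int n)"
    using cyc_diff_1[of "int (Suc n)"] Suc.prems cyc_diff_Suc[of 0 "int (Suc n)"] by simp
  moreover have "int p dvd cyc_diff 0 (int n) - (- 1) ^ n"
    using Suc by (simp add: cong_iff_dvd_diff)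
  ultimately have "int p dvd (cyc_diff 0 (int (Suc n)) + cyc_diff 0 (int n)) - (cyc_diff 0 (int n) - (- 1) ^ n)"
    by (rule dvd_diff)
  then show ?case
    by (simp add: cong_iff_dvd_diff)
qed

text \<open>The second hypothesis gives the upper index \<open>p - 1 + (K - s)\<close>; the last two
  keep \<open>N + m - s\<close> in the range where \<open>cyc_diff\<close> is known.\<close>

lemma alternating_congruence:
  assumes "K \<le> M" "M + N + 1 = p + K" "K \<le> N + m" "N + m < 2 * p"
  shows "[(\<Sum>i\<le>M. ibinom (int i - a) (int K) * int (M choose i) *
      (ibinom (int N) (int i - int m) - ibinom (int N) (int i - (int m - int p)))) =
    (- 1) ^ (N + m - K) * int (M choose K)] (mod int p)" (is "[?S = _] (mod _)")
proof -
  have "?S =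
      (\<Sum>s\<le>K. ibinom (- a) (int (K - s)) * int (M choose s) *
        ibinom (int (M - s + N)) (int N + int m - int s)) -
      (\<Sum>s\<le>K. ibinom (- a) (int (K - s)) * int (M choose s) *
        ibinom (int (M - s + N)) (int N + (int m - int p) - int s))"
    using assms(1)
    by (simp only: right_diff_distrib sum_subtractf sum_shifted_binomial_product)
  also have "\<dots> = (\<Sum>s\<le>K. ibinom (- a) (int (K - s)) * int (M choose s) *
      cyc_diff (K - s) (int (N + m) - int s))"
    unfolding sum_subtractf[symmetric] right_diff_distrib[symmetric]
  proof (rule sum.cong)
    fix s assume "s \<in> {..K}"
    then have "M - s + N = p - 1 + (K - s)"
      using assms prime_gt_0_nat[OF prime_p] by auto
    then show "ibinom (- a) (int (K - s)) * int (M choose s) * (ibinom (int (M - s + N)) (int N + int m - int s) -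
        ibinom (int (M - s + N)) (int N + (int m - int p) - int s)) =
      ibinom (- a) (int (K - s)) * int (M choose s) * cyc_diff (K - s) (int (N + m) - int s)"
      by (simp add: cyc_diff_def algebra_simps)
  qed simp
  also have "\<dots> = (\<Sum>s<K. ibinom (- a) (int (K - s)) * int (M choose s) * cyc_diff (K - s) (int (N + m) - int s))
      + int (M choose K) * cyc_diff 0 (int (N + m - K))"
    using assms(3) ibinom_of_nat[of 0 0]
    by (simp add: lessThan_Suc_atMost[symmetric] of_nat_diff ibinom_def)
  also have "[\<dots> = 0 + int (M choose K) * (- 1) ^ (N + m - K)] (mod int p)"
  proof (intro cong_add cong_mult cong_refl cyc_diff_0)
    have "int p dvd cyc_diff (K - s) (int (N + m) - int s)" if "s < K" for s
    proof -
      have "K - s = Suc (K - s - 1)"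
        using that by simp
      moreover have "int p dvd cyc_diff (Suc (K - s - 1)) (int (N + m) - int s)"
        using that assms by (intro cyc_diff_Suc_dvd) auto
      ultimately show ?thesis
        by simp
    qed
    then show "[(\<Sum>s<K. ibinom (- a) (int (K - s)) * int (M choose s) * cyc_diff (K - s) (int (N + m) - int s)) = 0] (mod int p)"
      unfolding cong_0_iff by (intro dvd_sum dvd_mult) auto
  qed (use assms in auto)
  finally show ?thesis
    by (simp add: mult.commute)
qed

end

section \<open>Rewriting \<open>f\<close> as a single sum\<close>

lemma f_sum_eq:
  fixes K a c' e :: nat and l :: int
  defines "M \<equiv> K + a + c'" and "N \<equiv> 2 * K + e" and "p \<equiv> 2 * K + 1 + a + c' + e"
  assumes "1 \<le> l" "l \<le> int (M + 1)"
  shows "f_sum (int p) (int K + 1) (int (K + 1 + c')) (int (K + a)) l =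
    (\<Sum>i\<le>M. ibinom (int i - int a) (int K) * int (M choose i) *
      (ibinom (int N) (int i - (int a - 1 + l)) - ibinom (int N) (int i - ((int a - 1 + l) - int p))))"
proof -
  define b where "b = (\<lambda>i::nat. ibinom (int i - int a) (int K) * int (M choose i))"
  have eqs: "int (K + 1 + c') + int (K + a) - (int K + 1) = int M"
      "int p - int (K + 1 + c') - int (K + a) + 2 * (int K + 1) - 2 = int N"
    by (simp_all add: M_def N_def p_def)
  have "C_sum (int p) (int K + 1) (int (K + 1 + c')) (int (K + a)) l =
      (\<Sum>i\<in>{K + a..M}. b i * ibinom (int N) (int i - (int a - 1 + l)))"
    \<comment> \<open>The new index is i = d + j - 1, where d = \<open>K + a\<close>.\<close>
    unfolding C_sum_def eqs
    by (rule sum.reindex_bij_witness[of _ "\<lambda>i. int i + 1 - int (K + a)" "\<lambda>j. nat (j + int (K + a) - 1)"])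
      (auto simp: b_def M_def algebra_simps simp flip: ibinom_of_nat)
  also have "\<dots> = (\<Sum>i\<le>M. b i * ibinom (int N) (int i - (int a - 1 + l)))"
  proof (rule sum.mono_neutral_left)
    show "\<forall>i\<in>{..M} - {K + a..M}. b i * ibinom (int N) (int i - (int a - 1 + l)) = 0"
    proof
      fix i assume i: "i \<in> {..M} - {K + a..M}"
      show "b i * ibinom (int N) (int i - (int a - 1 + l)) = 0"
      \<comment> \<open>Below \<open>a\<close> the last lower index is negative since
        \<open>l\<close> \<ge> 1; from \<open>a\<close> up to \<open>K + a - 1\<close> the factor
        binom(i - a, K) is zero.\<close>
      proof (cases "i < a")
        case True
        then show ?thesis using assms by (simp add: ibinom_neg)
      next
        case False
        then show ?thesis using i by (auto simp: b_def ibinom_eq_0)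
      qed
    qed
  qed auto
  finally have C: "C_sum (int p) (int K + 1) (int (K + 1 + c')) (int (K + a)) l =
    (\<Sum>i\<le>M. b i * ibinom (int N) (int i - (int a - 1 + l)))" .
  have "(- 1) ^ nat (int K + 1) * D_sum (int p) (int K + 1) (int (K + 1 + c')) (int (K + a)) l =
      (\<Sum>i\<in>{..<a}. - (b i * ibinom (int N) (int i - ((int a - 1 + l) - int p))))"
    unfolding D_sum_def eqs sum_distrib_left
  proof (rule sum.reindex_bij_witness[of _ "\<lambda>i. int i + 1" "\<lambda>j. nat (j - 1)"])
    fix j assume "j \<in> {1..int (K + a) + 1 - (int K + 1)}"
    then obtain i where i: "j = int i + 1"
      using zero_le_imp_eq_int[of "j - 1"] by (auto simp: algebra_simps)
    \<comment> \<open>The sign (-1)^K of upper negation meets (-1)^(K+1) from the definition of f,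
      leaving a minus sign.\<close>
    have "ibinom (int i - int a) (int K) = (- 1) ^ K * ibinom (int (K + a) - j) (int K)"
      by (subst ibinom_negated_upper) (simp add: i algebra_simps)
    moreover have "nat (int K + 1) = Suc K" by simp
    ultimately show "- (b (nat (j - 1)) * ibinom (int N) (int (nat (j - 1)) - (int a - 1 + l - int p))) =
       (- 1) ^ nat (int K + 1) * (ibinom (int (K + a) - j) (int K + 1 - 1) * ibinom (int M) (j - 1) *
         ibinom (int N) (int p + (int K + 1) + j - int (K + a) - 1 - l))"
      by (simp add: b_def i ibinom_of_nat algebra_simps)
  qed auto
  also have "\<dots> = (\<Sum>i\<le>M. - (b i * ibinom (int N) (int i - ((int a - 1 + l) - int p))))"
  proof (rule sum.mono_neutral_left)
    show "\<forall>i\<in>{..M} - {..<a}. - (b i * ibinom (int N) (int i - ((int a - 1 + l) - int p))) = 0"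
    proof
      fix i assume i: "i \<in> {..M} - {..<a}"
      show "- (b i * ibinom (int N) (int i - ((int a - 1 + l) - int p))) = 0"
      proof (cases "i < K + a")
        case True
        then show ?thesis using i by (auto simp: b_def ibinom_eq_0)
      next
        case False
        \<comment> \<open>From i \<ge> \<open>K + a\<close> and \<open>l\<close> \<le>
          \<open>M + 1\<close> the lower index is at least \<open>N + 1\<close>.\<close>
        then show ?thesis using assms by (auto simp: M_def N_def p_def intro!: ibinom_eq_0)
      qed
    qed
  qed (auto simp: M_def)
  finally show ?thesis
    unfolding f_sum_def C by (simp add: b_def sum_negf sum_subtractf right_diff_distrib)
qed

theorem theorem1:
  fixes p k c d :: int
  assumes "prime p"
    and "1 \<le> k" and "k \<le> c" and "c \<le> d" and "d < c + d" and "c + d \<le> p"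
  shows "\<not> [f_sum p k c d 1 = 0] (mod p) \<and>
    (\<forall>l\<in>{1..c + d + 1 - k}. [f_sum p k c d l = (-1) ^ nat (l - 1) * f_sum p k c d 1] (mod p))"
proof -
  \<comment> \<open>The hypotheses make these differences nonnegative, so \<open>vars\<close>
    recovers the integers exactly.\<close>
  define K a c' e where "K = nat (k - 1)" and "a = nat (d + 1 - k)" and "c' = nat (c - k)"
    and "e = nat (p - c - d)"
  define P M N where "P = 2 * K + 1 + a + c' + e" and "M = K + a + c'" and "N = 2 * K + e"
  have vars: "p = int P" "k = int K + 1" "c = int (K + 1 + c')" "d = int (K + a)" "1 \<le> a"
    using assms by (auto simp: K_def a_def c'_def e_def P_def)
  have P: "prime P"
    using assms(1) vars by simp
  have f: "[f_sum p k c d l = (- 1) ^ nat (l - 1) * ((- 1) ^ (N + a - K) * int (M choose K))] (mod p)"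
    if l: "l \<in> {1..c + d + 1 - k}" for l
  proof -
    have l': "1 \<le> l" "l \<le> int (M + 1)"
      using l by (auto simp: vars M_def)
    define m where "m = nat (int a - 1 + l)"
    have m: "int a - 1 + l = int m"
      using l' by (simp add: m_def)
    have exponent: "N + m - K = nat (l - 1) + (N + a - K)"
      using l' vars(5) by (auto simp: m_def N_def)
    \<comment> \<open>Hence \<open>N + m\<close> \<le> p - 1 + d < 2 p, the upper bound needed for
      the congruence.\<close>
    have "m \<le> M + a"
      using l' m by linarith
    then have "[f_sum p k c d l = (- 1) ^ (N + m - K) * int (M choose K)] (mod p)"
      unfolding vars using vars(5) assms(3,4) l'
      using f_sum_eq[of l K a c' e, folded M_def N_def P_def, unfolded m]
        alternating_congruence[OF P, of K M N m "int a"]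
      by (simp add: M_def N_def P_def)
    then show ?thesis
      by (simp add: exponent power_add mult.assoc)
  qed
  \<comment> \<open>The coefficient divides M!, and the prime \<open>P\<close> exceeds
    \<open>M\<close>.\<close>
  have "\<not> P dvd (M choose K)"
  proof
    assume "P dvd (M choose K)"
    moreover have "(M choose K) dvd fact M"
      using binomial_fact_lemma[of K M] by (metis M_def dvd_triv_right le_add1 add.assoc)
    ultimately have "P \<le> M"
      using P prime_dvd_fact_iff dvd_trans by blast
    then show False
      by (simp add: P_def M_def)
  qed
  then have "\<not> p dvd (- 1) ^ (N + a - K) * int (M choose K)"
    by (cases "even (N + a - K)") (simp_all add: vars)
  moreover have one: "[f_sum p k c d 1 = (- 1) ^ (N + a - K) * int (M choose K)] (mod p)"
    using f[of 1] assms by simp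
  ultimately have "\<not> [f_sum p k c d 1 = 0] (mod p)"
    by (metis cong_0_iff cong_sym cong_trans)
  moreover have "[f_sum p k c d l = (- 1) ^ nat (l - 1) * f_sum p k c d 1] (mod p)"
    if "l \<in> {1..c + d + 1 - k}" for l
    using f[OF that] cong_mult[OF cong_refl cong_sym[OF one]] by (rule cong_trans)
  ultimately show ?thesis
    by blast
qed

end
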